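(* Let $A=(a_{ij})\in M_C$ be a consistent matrix of order $n$, and let $i\ne j$ be indices with $a_{ij}\neq 1$. For real $\delta>0$ let $A^{\delta}$ denote the matrix obtained from $A$ by replacing the entry $a_{ij}$ by $a_{ij}^{\delta}$ and the entry $a_{ji}$ by $a_{ji}^{\delta}$, all other entries being unchanged. Then the function $\delta\mapsto KII(A^{\delta})$ is non-decreasing for $\delta>1$ and non-increasing for $0<\delta<1$.
   Context: $M_R$ is the set of all real $n\times n$ matrices $A=(a_{ij})$ with $a_{ij}>0$ for all $i,j$ and $a_{ij}=1/a_{ji}$ for all $i,j$ (reciprocal matrices). $M_C\subset M_R$ is the set of all real $n\times n$ matrices with $a_{ij}>0$ for all $i,j$ and $a_{ij}a_{jk}=a_{ik}$ for all $i,j,k$ (consistent matrices). Koczkodaj's inconsistency index of $A\in M_R$ is $$KII(A)=\max_{i,j,k\in\{1,\dots,n\}}\ \min\left(\left|1-\frac{a_{ik}}{a_{ij}a_{jk}}\right|,\ \left|1-\frac{a_{ij}a_{jk}}{a_{ik}}\right|\right).$$ *)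

theory Defs
  imports "HOL-Analysis.Analysis"
begin

definition reciprocal_matrices :: "(real ^ 'n ^ 'n) set" where
  "reciprocal_matrices = {A. \<forall>i j. A $ i $ j > 0 \<and> A $ i $ j = 1 / A $ j $ i}"

definition consistent_matrices :: "(real ^ 'n ^ 'n) set" where
  "consistent_matrices =
     {A. (\<forall>i j. A $ i $ j > 0) \<and> (\<forall>i j k. A $ i $ j * A $ j $ k = A $ i $ k)}"

definition KII :: "real ^ 'n ^ 'n \<Rightarrow> real" where
  "KII A = Max (range (\<lambda>(i, j, k).
     min \<bar>1 - A $ i $ k / (A $ i $ j * A $ j $ k)\<bar> \<bar>1 - A $ i $ j * A $ j $ k / A $ i $ k\<bar>))"

definition perturb :: "real ^ 'n ^ 'n \<Rightarrow> 'n \<Rightarrow> 'n \<Rightarrow> real \<Rightarrow> real ^ 'n ^ 'n" where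
  "perturb A i j \<delta> =
     (\<chi> k l. if (k, l) = (i, j) \<or> (k, l) = (j, i) then A $ k $ l powr \<delta> else A $ k $ l)"

lemma consistent_subset_reciprocal: "consistent_matrices \<subseteq> reciprocal_matrices"
proof
  fix A :: "real ^ 'n ^ 'n" assume A: "A \<in> consistent_matrices"
  have pos: "A $ i $ j > 0" and mult: "A $ i $ j * A $ j $ k = A $ i $ k" for i j k
    using A by (auto simp: consistent_matrices_def)
  have "A $ i $ i = 1" for i
    using mult[of i i i] pos[of i i] by simp
  then have "A $ i $ j = 1 / A $ j $ i" for i j
    using mult[of i j i] pos[of j i] by (metis nonzero_eq_divide_eq order_less_irrefl)
  then show "A \<in> reciprocal_matrices"
    unfolding reciprocal_matrices_def using pos by blast
qed

lemma perturb_reciprocal: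
  assumes "A \<in> reciprocal_matrices"
  shows "perturb A i j \<delta> \<in> reciprocal_matrices"
proof -
  have pos: "A $ k $ l > 0" and rec: "A $ k $ l = 1 / A $ l $ k" for k l
    using assms unfolding reciprocal_matrices_def by blast+
  have rec': "A $ k $ l powr \<delta> = 1 / A $ l $ k powr \<delta>" for k l
  proof -
    have "(1 / A $ l $ k) powr \<delta> = 1 / A $ l $ k powr \<delta>"
      using pos[of l k] by (simp add: powr_divide)
    then show ?thesis
      by (simp only: rec[of k l, symmetric])
  qed
  have "perturb A i j \<delta> $ k $ l > 0" for k l
    using pos[of k l] by (simp add: perturb_def)
  moreover have "perturb A i j \<delta> $ k $ l = 1 / perturb A i j \<delta> $ l $ k" for k l
  proof (cases "(k, l) = (i, j) \<or> (k, l) = (j, i)")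
    case True
    then have "(l, k) = (i, j) \<or> (l, k) = (j, i)" by blast
    with True show ?thesis
      unfolding perturb_def vec_lambda_beta by (simp only: if_True rec'[of k l])
  next
    case False
    then have "\<not> ((l, k) = (i, j) \<or> (l, k) = (j, i))" by blast
    with False show ?thesis
      unfolding perturb_def vec_lambda_beta by (simp only: if_False rec[of k l])
  qed
  ultimately show ?thesis
    unfolding reciprocal_matrices_def by blast
qed

end

theory Submission
  imports Defs
begin

text \<open>
  Perturbing adds \<open>(\<delta> - 1) * ln (A $ i $ j)\<close> to the logarithm of the \<open>(i, j)\<close> entry and its
  negative to that of the \<open>(j, i)\<close> entry. Consistency cancels all unperturbed logarithms in the
  defect of a triad, which is therefore \<open>\<delta> - 1\<close> times a constant \<open>c\<close>; the triad contributes
  \<open>1 - exp (- (\<bar>\<delta> - 1\<bar> * \<bar>c\<bar>))\<close>, which increases with \<open>\<bar>\<delta> - 1\<bar>\<close>.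
\<close>

text \<open>Both sides are even in \<open>t\<close>, so \<open>t \<ge> 0\<close> suffices; there the
  decaying exponential stays closer to 1.\<close>

lemma min_abs_one_minus_exp:
  fixes t :: real
  shows "min \<bar>1 - exp t\<bar> \<bar>1 - exp (- t)\<bar> = 1 - exp (- \<bar>t\<bar>)"
proof -
  have *: "min \<bar>1 - exp s\<bar> \<bar>1 - exp (- s)\<bar> = 1 - exp (- s)" if "s \<ge> 0" for s :: real
  proof -
    \<comment> \<open>Adding the tangent bounds at \<open>s\<close> and \<open>- s\<close> gives
      \<open>2 \<le> exp s + exp (- s)\<close>.\<close>
    have "1 - exp (- s) \<le> exp s - 1"
      using exp_ge_add_one_self[of s] exp_ge_add_one_self[of "- s"] by linarith
    moreover have "exp (- s) \<le> 1" "1 \<le> exp s"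
      using that by simp_all
    ultimately show ?thesis by (simp add: min_def)
  qed
  show ?thesis
    using *[of t] *[of "- t"] by (cases "t \<ge> 0") (simp_all add: min.commute)
qed

text \<open>For positive entries, this is the \<delta>-derivative of the logarithm of the perturbed
  entry.\<close>

definition log_shift :: "real ^ 'n ^ 'n \<Rightarrow> 'n \<Rightarrow> 'n \<Rightarrow> 'n \<Rightarrow> 'n \<Rightarrow> real" where
  "log_shift A i j k l = (if (k, l) = (i, j) \<or> (k, l) = (j, i) then ln (A $ k $ l) else 0)"

lemma perturb_eq_mult_exp:
  assumes "A $ k $ l > 0"
  shows "perturb A i j \<delta> $ k $ l = A $ k $ l * exp ((\<delta> - 1) * log_shift A i j k l)"
proof -
  have "A $ k $ l powr \<delta> = A $ k $ l * exp ((\<delta> - 1) * ln (A $ k $ l))"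
    using assms powr_add[of "A $ k $ l" 1 "\<delta> - 1"] by (simp add: powr_def)
  then show ?thesis
    by (simp add: perturb_def log_shift_def)
qed

definition triad_defect :: "real ^ 'n ^ 'n \<Rightarrow> 'n \<Rightarrow> 'n \<Rightarrow> 'n \<times> 'n \<times> 'n \<Rightarrow> real" where
  "triad_defect A i j = (\<lambda>(k, l, m).
     log_shift A i j k m - log_shift A i j k l - log_shift A i j l m)"

lemma KII_perturb:
  assumes "A \<in> consistent_matrices"
  shows "KII (perturb A i j \<delta>) =
    Max (range (\<lambda>t. 1 - exp (- (\<bar>\<delta> - 1\<bar> * \<bar>triad_defect A i j t\<bar>))))"
proof -
  let ?B = "perturb A i j \<delta>"
  have pos: "A $ k $ l > 0" and mult: "A $ k $ l * A $ l $ m = A $ k $ m" for k l m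
    using assms by (auto simp: consistent_matrices_def)
  have ratio: "?B $ k $ m / (?B $ k $ l * ?B $ l $ m) =
      exp ((\<delta> - 1) * triad_defect A i j (k, l, m))" for k l m
  proof -
    have "?B $ k $ l * ?B $ l $ m =
        A $ k $ m * exp ((\<delta> - 1) * (log_shift A i j k l + log_shift A i j l m))"
      \<comment> \<open>Consistency enters here: \<open>A $ k $ l * A $ l $ m\<close> collapses to
        \<open>A $ k $ m\<close>, which then cancels in the ratio.\<close>
      by (simp add: perturb_eq_mult_exp[OF pos] mult[symmetric, of k m l] distrib_left exp_add)
    then show ?thesis
      using pos[of k m]
      by (simp add: perturb_eq_mult_exp[OF pos] exp_diff[symmetric] triad_defect_def algebra_simps)
  qed
  have inverse_ratio: "?B $ k $ l * ?B $ l $ m / ?B $ k $ m =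
      exp (- ((\<delta> - 1) * triad_defect A i j (k, l, m)))" for k l m
    by (metis ratio exp_minus inverse_divide)
  show ?thesis
    unfolding KII_def ratio inverse_ratio min_abs_one_minus_exp
    by (simp add: abs_mult case_prod_unfold)
qed

text \<open>Measuring by distance from 1 lets one inequality serve both sides of 1.\<close>

lemma KII_perturb_mono:
  assumes "A \<in> consistent_matrices" and "\<bar>\<delta> - 1\<bar> \<le> \<bar>\<epsilon> - 1\<bar>"
  shows "KII (perturb A i j \<delta>) \<le> KII (perturb A i j \<epsilon>)"
proof -
  let ?f = "\<lambda>\<delta> t. 1 - exp (- (\<bar>\<delta> - 1\<bar> * \<bar>triad_defect A i j t\<bar>))"
  have "?f \<delta> t \<le> Max (range (?f \<epsilon>))" for t
  proof -
    have "?f \<delta> t \<le> ?f \<epsilon> t"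
      using assms(2) by (simp add: mult_right_mono)
    also have "\<dots> \<le> Max (range (?f \<epsilon>))"
      by (rule Max_ge) auto
    finally show ?thesis .
  qed
  then have "Max (range (?f \<delta>)) \<le> Max (range (?f \<epsilon>))"
    by (intro Max.boundedI) auto
  then show ?thesis
    by (simp only: KII_perturb[OF assms(1)])
qed

theorem proposition15:
  fixes A :: "real ^ 'n ^ 'n" and i j :: 'n
  assumes "A \<in> consistent_matrices"
    and "i \<noteq> j"
    and "A $ i $ j \<noteq> 1"
  shows "mono_on {1<..} (\<lambda>\<delta>. KII (perturb A i j \<delta>))
       \<and> antimono_on {0<..<1} (\<lambda>\<delta>. KII (perturb A i j \<delta>))"
  \<comment> \<open>The distance \<open>\<bar>\<delta> - 1\<bar>\<close> grows with \<delta> above 1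
    and shrinks below 1.\<close>
  using KII_perturb_mono[OF assms(1)] by (auto intro!: monotone_onI)

end
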